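(* Assume that there is a partition $\mathcal{P}=\{I_l : l\in\mathbb{N}\}$ of $\mathbb{N}$ such that for each $l$ there are infinitely many $n$ with $n,n+1\in I_l$, and such that $\mathfrak{d}'(\mathcal{P})=\mathfrak{d}$. Then for each natural number $k$ there is a subgroup $G$ of $\mathbb{Z}^{\mathbb{N}}$ such that $G^k$ is Menger-bounded, but $G^{k+1}$ is not Menger-bounded.
   Context: $\mathbb{N}=\{0,1,2,\dots\}$, and $\mathbb{N}^{\mathbb{N}}$ is the set of all functions from $\mathbb{N}$ to $\mathbb{N}$. "Increasing" means strictly increasing. $\mathbb{Z}^{\mathbb{N}}$ is the Baer-Specker group: the abelian group of all functions $\mathbb{N}\to\mathbb{Z}$ with coordinate-wise addition and the product topology ($\mathbb{Z}$ discrete). Subgroups carry the subspace topology. $G^k$ is the direct product of $k$ copies of $G$ with the product topology. A topological group $(H,\cdot)$ is Menger-bounded if for each sequence $(U_n)_{n\in\mathbb{N}}$ of neighborhoods of the unit of $H$ there exist finite sets $F_n\subseteq H$, $n\in\mathbb{N}$, such that $H=\bigcup_n F_n\cdot U_n$, where $A\cdot B=\{a\cdot b: a\in A, b\in B\}$. For $f,g\in\mathbb{N}^{\mathbb{N}}$, $f\le^* g$ means $f(n)\le g(n)$ for all but finitely many $n$. A set $Y\subseteq\mathbb{N}^{\mathbb{N}}$ is dominating if for each $f\in\mathbb{N}^{\mathbb{N}}$ there is $g\in Y$ with $f\le^* g$. $\mathfrak{d}$ is the minimal cardinality of a dominating subset of $\mathbb{N}^{\mathbb{N}}$. Let $\mathcal{P}=\{I_l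 : l\in\mathbb{N}\}$ be a partition of $\mathbb{N}$ (the sets $I_l$ pairwise disjoint with union $\mathbb{N}$) such that for each $l$ there are infinitely many $n$ with $n,n+1\in I_l$. For $f\in\mathbb{N}^{\mathbb{N}}$ and increasing $h\in\mathbb{N}^{\mathbb{N}}$, write $[f\ll h]=\{n : f(h(n))<h(n+1)\}$. The cardinal $\mathfrak{d}'(\mathcal{P})$ is the least cardinality of a set $Y\subseteq\mathbb{N}^{\mathbb{N}}$ for which there is no increasing $h\in\mathbb{N}^{\mathbb{N}}$ such that for every $f\in Y$ and every $l\in\mathbb{N}$ there are infinitely many $n$ with $n,n+1\in I_l\cap[f\ll h]$. *)

theory Defs
  imports
    "HOL-Analysis.Analysis"
    "HOL-Algebra.Product_Groups"
    "HOL-Library.Infinite_Set"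
begin

unbundle cardinal_syntax

section \<open>Menger-bounded groups\<close>

text \<open>
  A topological group is given by a group \<open>H\<close> together with a topology \<open>T\<close>
  on its carrier; neighbourhoods of the unit are not required to be open.
\<close>

definition unit_nbhd :: "('a, 'm) monoid_scheme \<Rightarrow> 'a topology \<Rightarrow> 'a set \<Rightarrow> bool" where
  "unit_nbhd H T U \<longleftrightarrow> U \<subseteq> topspace T \<and> (\<exists>V. openin T V \<and> \<one>\<^bsub>H\<^esub> \<in> V \<and> V \<subseteq> U)"

definition menger_bounded :: "('a, 'm) monoid_scheme \<Rightarrow> 'a topology \<Rightarrow> bool" where
  "menger_bounded H T \<longleftrightarrow>
     (\<forall>U :: nat \<Rightarrow> 'a set. (\<forall>n. unit_nbhd H T (U n)) \<longrightarrow>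
       (\<exists>F :: nat \<Rightarrow> 'a set. (\<forall>n. finite (F n) \<and> F n \<subseteq> carrier H) \<and>
          carrier H = (\<Union>n. F n <#>\<^bsub>H\<^esub> U n)))"

definition baer_specker :: "(nat \<Rightarrow> int) monoid" where
  "baer_specker = product_group UNIV (\<lambda>_. integer_group)"

definition baer_specker_top :: "(nat \<Rightarrow> int) topology" where
  "baer_specker_top = product_topology (\<lambda>_. discrete_topology UNIV) UNIV"

text \<open>
  The power \<open>G\<^sup>k\<close> of a subgroup \<open>G\<close> of the Baer-Specker group, with the product of
  the subspace topologies. The index set of the product is \<open>{..<k}\<close>, so \<open>G\<^sup>0\<close> is trivial.
\<close>

definition bs_power :: "(nat \<Rightarrow> int) set \<Rightarrow> nat \<Rightarrow> (nat \<Rightarrow> nat \<Rightarrow> int) monoid" where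
  "bs_power G k = product_group {..<k} (\<lambda>_. baer_specker\<lparr>carrier := G\<rparr>)"

definition bs_power_top :: "(nat \<Rightarrow> int) set \<Rightarrow> nat \<Rightarrow> (nat \<Rightarrow> nat \<Rightarrow> int) topology" where
  "bs_power_top G k = product_topology (\<lambda>_. subtopology baer_specker_top G) {..<k}"

section \<open>Cardinal invariants\<close>

text \<open>
  The least cardinality of a set satisfying \<open>\<Phi>\<close>: cardinals are compared up to order
  isomorphism, so the cardinal of any set of minimal cardinality represents it. It is
  meaningful whenever some set satisfies \<open>\<Phi>\<close>.
\<close>

definition least_card :: "('a set \<Rightarrow> bool) \<Rightarrow> 'a rel" where
  "least_card \<Phi> = |SOME Y. \<Phi> Y \<and> (\<forall>Z. \<Phi> Z \<longrightarrow> |Y| \<le>o |Z| )|"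

lemma least_card:
  assumes "\<Phi> Y"
  obtains X where "\<Phi> X" "least_card \<Phi> = |X|" "\<And>Z. \<Phi> Z \<Longrightarrow> |X| \<le>o |Z|"
proof -
  have "wf (inv_image ordLess (card_of :: 'a set \<Rightarrow> 'a rel))"
    using wf_ordLess by (rule wf_inv_image)
  then obtain X where X: "\<Phi> X" "\<And>Z. ( |Z|, |X| ) \<in> ordLess \<Longrightarrow> \<not> \<Phi> Z"
    using assms unfolding wf_eq_minimal by (metis in_inv_image mem_Collect_eq)
  have "\<Phi> X \<and> (\<forall>Z. \<Phi> Z \<longrightarrow> |X| \<le>o |Z| )"
    using X by (metis card_of_Well_order not_ordLeq_iff_ordLess)
  then have "\<Phi> (SOME Y. \<Phi> Y \<and> (\<forall>Z. \<Phi> Z \<longrightarrow> |Y| \<le>o |Z| )) \<and>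
    (\<forall>Z. \<Phi> Z \<longrightarrow> |SOME Y. \<Phi> Y \<and> (\<forall>Z. \<Phi> Z \<longrightarrow> |Y| \<le>o |Z| )| \<le>o |Z| )"
    by (rule someI)
  then show thesis
    using that unfolding least_card_def by blast
qed

definition dominating :: "(nat \<Rightarrow> nat) set \<Rightarrow> bool" where
  "dominating Y \<longleftrightarrow> (\<forall>f. \<exists>g\<in>Y. \<forall>\<^sub>\<infinity>n. f n \<le> g n)"

definition cardinal_d :: "(nat \<Rightarrow> nat) rel" where
  "cardinal_d = least_card dominating"

definition admissible_partition :: "(nat \<Rightarrow> nat set) \<Rightarrow> bool" where
  "admissible_partition I \<longleftrightarrow>
     disjoint_family I \<and> (\<Union>l. I l) = UNIV \<and>
     (\<forall>l. \<exists>\<^sub>\<infinity>n. n \<in> I l \<and> n + 1 \<in> I l)"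

definition much_less :: "(nat \<Rightarrow> nat) \<Rightarrow> (nat \<Rightarrow> nat) \<Rightarrow> nat set" (\<open>[_ \<lless> _]\<close>) where
  "[f \<lless> h] = {n. f (h n) < h (n + 1)}"

definition unescapable :: "(nat \<Rightarrow> nat set) \<Rightarrow> (nat \<Rightarrow> nat) set \<Rightarrow> bool" where
  "unescapable I Y \<longleftrightarrow>
     \<not> (\<exists>h. strict_mono h \<and>
          (\<forall>f\<in>Y. \<forall>l. \<exists>\<^sub>\<infinity>n. n \<in> I l \<inter> [f \<lless> h] \<and> n + 1 \<in> I l \<inter> [f \<lless> h]))"

definition cardinal_d' :: "(nat \<Rightarrow> nat set) \<Rightarrow> (nat \<Rightarrow> nat) rel" where
  "cardinal_d' I = least_card (unescapable I)"

lemma dominating_UNIV: "dominating UNIV"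
  unfolding dominating_def by (metis MOST_I UNIV_I order_refl)

lemma unescapable_UNIV: "unescapable I UNIV"
proof -
  have False if h: "strict_mono h"
    and inf: "\<And>f l. \<exists>\<^sub>\<infinity>n. n \<in> I l \<inter> [f \<lless> h] \<and> n + 1 \<in> I l \<inter> [f \<lless> h]" for h :: "nat \<Rightarrow> nat"
  proof -
    define f where "f = (\<lambda>m. h (inv_into UNIV h m + 1))"
    have "f (h n) = h (n + 1)" for n
      using h by (simp add: f_def strict_mono_imp_inj_on)
    then have "[f \<lless> h] = {}"
      by (simp add: much_less_def)
    then show False
      using inf[of 0 f] by simp
  qed
  then show ?thesis
    unfolding unescapable_def by blast
qed

end

(*
Let D be a dominating family of minimal cardinality, well-ordered so that initial segments are
smaller than D. Recursively choose, for every d in D, a (k+1)-tuple g_d in Z^N such that for every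
n some entry of g_d exceeds d(n) in absolute value at n; G is the group generated by the entries of
all g_d. For every function f, a multiple of some g_d then exceeds f at every n, so G^(k+1) is not
Menger-bounded.

A k-tuple of elements of G is a finite sum of products A g_d with A an integer matrix of size
k x (k+1). Such a matrix has a nonzero kernel vector, and the partition lets g_d follow a kernel
vector of every one of the countably many matrices on infinitely many pairs of consecutive long
segments, chosen by the cardinal d'(P). Stage e of the recursion fixes a function f_e that bounds
infinitely often every k-tuple built before e, on the blocks [0, e m). Adding A g_d at a later
stage d increases this bound from c f_e to at most (c + 1) f_e, infinitely often. Hence
m |-> m f_e(m) serves for all k-tuples of G.
*)
theory Submission
  imports Defs
begin

section \<open>Kernel vectors of matrices with more columns than rows\<close>

text \<open>Gaussian elimination by induction on the number of rows. Cross-multiplication replaces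
  division, so integer matrices get integer kernel vectors.\<close>

lemma kernel_vector:
  fixes A :: "nat \<Rightarrow> 'b \<Rightarrow> 'a::idom"
  assumes "finite J" "k < card J"
  shows "\<exists>v. (\<exists>j\<in>J. v j \<noteq> 0) \<and> (\<forall>i<k. (\<Sum>j\<in>J. A i j * v j) = 0)"
  using assms
proof (induction k arbitrary: A J)
  case 0
  then have "J \<noteq> {}" by auto
  then show ?case by (auto intro!: exI[of _ "\<lambda>_. 1"])
next
  case (Suc k)
  show ?case
  proof (cases "\<forall>j\<in>J. A k j = 0")
    case True
    obtain v where "\<exists>j\<in>J. v j \<noteq> 0" "\<forall>i<k. (\<Sum>j\<in>J. A i j * v j) = 0"
      using Suc.IH[of J A] Suc.prems by auto
    with True show ?thesis
      by (intro exI[of _ v]) (auto simp: less_Suc_eq)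
  next
    case False
    then obtain p where p: "p \<in> J" "A k p \<noteq> 0" by blast
    define J' where "J' = J - {p}"
    have J: "J = insert p J'" "p \<notin> J'" "finite J'"
      using p Suc.prems by (auto simp: J'_def)
    define B where "B i j = A k p * A i j - A i p * A k j" for i j
    obtain v where v: "\<exists>j\<in>J'. v j \<noteq> 0" "\<And>i. i < k \<Longrightarrow> (\<Sum>j\<in>J'. B i j * v j) = 0"
      using Suc.IH[of J' B] Suc.prems J by auto
    \<comment> \<open>The entry at \<open>p\<close> solves row \<open>k\<close> once all other
      entries are multiplied by the pivot \<open>A k p\<close>. These stay nonzero where
      \<open>v\<close> was, as there are no zero divisors.\<close>
    define w where "w j = (if j = p then - (\<Sum>j\<in>J'. A k j * v j) else A k p * v j)" for j
    have w: "(\<Sum>j\<in>J. A i j * w j) = (\<Sum>j\<in>J'. B i j * v j)" for i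
    proof -
      have "(\<Sum>j\<in>J. A i j * w j) = A i p * w p + (\<Sum>j\<in>J'. A i j * w j)"
        using J by simp
      also have "(\<Sum>j\<in>J'. A i j * w j) = (\<Sum>j\<in>J'. A i j * (A k p * v j))"
        using J by (intro sum.cong) (auto simp: w_def)
      also have "A i p * w p + \<dots> = (\<Sum>j\<in>J'. B i j * v j)"
        by (simp add: w_def B_def sum_distrib_left sum_negf algebra_simps sum_subtractf)
      finally show ?thesis .
    qed
    moreover have "B k j = 0" for j
      by (simp add: B_def)
    moreover have "\<exists>j\<in>J. w j \<noteq> 0"
    proof -
      obtain j where "j \<in> J'" "v j \<noteq> 0"
        using v(1) by blast
      then show ?thesis
        using J p by (intro bexI[of _ j]) (auto simp: w_def)
    qed
    ultimately show ?thesis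
      using v(2) by (intro exI[of _ w]) (auto simp: less_Suc_eq)
  qed
qed

section \<open>Sets of small cardinality\<close>

text \<open>The summand \<open>nat\<close> makes \<open>C\<close> infinite without reaching
  \<open>|D|\<close>, and an infinite cardinal absorbs products.\<close>

lemma Times_ordLess:
  assumes D: "|UNIV :: nat set| <o |D|" and "|A| <o |D|" "|B| <o |D|"
  shows "|A \<times> B| <o |D|"
proof -
  define C where "C = A <+> B <+> (UNIV :: nat set)"
  have inf: "infinite D"
    using D infinite_iff_card_of_nat ordLess_imp_ordLeq by blast
  have C: "|C| <o |D|"
    unfolding C_def using assms inf by (intro card_of_Plus_ordLess_infinite)
  have "infinite C"
    by (simp add: C_def)
  moreover have "|A| \<le>o |C|"
    unfolding C_def by (rule card_of_Plus1)
  moreover have "|B| \<le>o |C|"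
    unfolding C_def by (meson card_of_Plus1 card_of_Plus2 ordLeq_transitive)
  ultimately have "|A \<times> B| \<le>o |C|"
    using card_of_Times_ordLeq_infinite_Field[OF _ _ _ card_of_Card_order, of C A B]
    by (simp add: Field_card_of)
  then show ?thesis
    using C by (rule ordLeq_ordLess_trans)
qed

text \<open>The lists of each fixed length embed into powers of an infinite \<open>C\<close> smaller
  than \<open>D\<close>, and the union over all lengths is countable.\<close>

lemma lists_ordLess:
  assumes D: "|UNIV :: nat set| <o |D|" and "|A| <o |D|"
  shows "|lists A| <o |D|"
proof -
  define C where "C = A <+> (UNIV :: nat set)"
  have inf: "infinite D"
    using D infinite_iff_card_of_nat ordLess_imp_ordLeq by blast
  have C: "|C| <o |D|"
    unfolding C_def using assms inf by (intro card_of_Plus_ordLess_infinite)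
  have infC: "infinite C"
    by (simp add: C_def)
  have A: "|A| \<le>o |C|"
    unfolding C_def by (rule card_of_Plus1)
  have "|{xs \<in> lists A. length xs = n}| \<le>o |C|" for n
  proof (induction n)
    case 0
    have "{xs \<in> lists A. length xs = 0} = {[]}" by auto
    moreover have "C \<noteq> {}" using infC by auto
    ultimately show ?case
      by (auto intro: card_of_singl_ordLeq)
  next
    case (Suc n)
    have "{xs \<in> lists A. length xs = Suc n} \<subseteq>
        (\<lambda>(a, xs). a # xs) ` (A \<times> {xs \<in> lists A. length xs = n})"
      by (auto simp: length_Suc_conv image_iff)
    then have "|{xs \<in> lists A. length xs = Suc n}| \<le>o |A \<times> {xs \<in> lists A. length xs = n}|"
      by (rule surj_imp_ordLeq)
    also have "|A \<times> {xs \<in> lists A. length xs = n}| \<le>o |C|"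
      using card_of_Times_ordLeq_infinite_Field[OF _ A Suc card_of_Card_order] infC
      by (simp add: Field_card_of)
    finally show ?case .
  qed
  then have "|\<Union>n. {xs \<in> lists A. length xs = n}| \<le>o |C|"
    using infC infinite_iff_card_of_nat by (intro card_of_UNION_ordLeq_infinite) auto
  moreover have "lists A = (\<Union>n. {xs \<in> lists A. length xs = n})"
    by auto
  ultimately show ?thesis
    using ordLeq_ordLess_trans[OF _ C] by simp
qed

section \<open>Sets below the cardinals d and d'\<close>

text \<open>The witness \<open>Y\<^sub>0\<close> makes the choice behind \<open>least_card\<close>
  meaningful.\<close>

lemma least_card_ordLess:
  assumes "|Z| <o least_card \<Phi>" "\<Phi> Y\<^sub>0"
  shows "\<not> \<Phi> Z"
proof (rule least_card[of \<Phi>, OF assms(2)])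
  fix X
  assume "least_card \<Phi> = |X|" and min: "\<And>Z. \<Phi> Z \<Longrightarrow> |X| \<le>o |Z|"
  then show ?thesis
    using assms(1) min[of Z] not_ordLess_ordLeq[of "|Z|" "|X|"] by auto
qed

text \<open>Diagonalization: if \<open>q\<close> enumerates a countable family, then
  \<open>f\<close> exceeds \<open>q p\<close> at every \<open>n \<ge> p\<close>.\<close>

lemma nat_ordLess_dominating:
  assumes "dominating D"
  shows "|UNIV :: nat set| <o |D|"
proof (rule ccontr)
  assume "\<not> ?thesis"
  then have "|D| \<le>o |UNIV :: nat set|"
    by (simp add: not_ordLess_iff_ordLeq card_of_Well_order)
  moreover have "D \<noteq> {}"
    using assms by (auto simp: dominating_def)
  ultimately obtain q :: "nat \<Rightarrow> nat \<Rightarrow> nat" where q: "q ` UNIV = D"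
    using card_of_ordLeq2[of D "UNIV :: nat set"] by blast
  define f where "f n = Suc (\<Sum>i\<le>n. q i n)" for n
  obtain p where "\<forall>\<^sub>\<infinity>n. f n \<le> q p n"
    using assms q unfolding dominating_def by blast
  then obtain N where N: "\<And>n. n \<ge> N \<Longrightarrow> f n \<le> q p n"
    by (auto simp: MOST_nat_le)
  have "q p (max N p) \<le> (\<Sum>i\<le>max N p. q i (max N p))"
    by (rule member_le_sum) auto
  then show False
    using N[of "max N p"] by (simp add: f_def)
qed

lemma small_not_dominating:
  fixes X :: "(nat \<Rightarrow> nat) set"
  assumes "|X| <o cardinal_d"
  shows "\<exists>f. \<forall>g\<in>X. \<exists>\<^sub>\<infinity>n. g n < f n"
proof -
  have "\<not> dominating X"
    using assms dominating_UNIV unfolding cardinal_d_def by (rule least_card_ordLess)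
  then show ?thesis
    by (simp add: dominating_def not_le)
qed

lemma small_escapable:
  assumes "|Y| <o cardinal_d' I"
  shows "\<exists>h. strict_mono h \<and>
    (\<forall>f\<in>Y. \<forall>l. \<exists>\<^sub>\<infinity>n. n \<in> I l \<inter> [f \<lless> h] \<and> n + 1 \<in> I l \<inter> [f \<lless> h])"
proof -
  have "\<not> unescapable I Y"
    using assms unescapable_UNIV unfolding cardinal_d'_def by (rule least_card_ordLess)
  then show ?thesis
    unfolding unescapable_def not_not .
qed

section \<open>One step of the construction\<close>

text \<open>A matrix with columns \<open>j \<le> k\<close> applied to a (k+1)-tuple of sequences. Of
  the resulting rows only those with \<open>i < k\<close> are ever inspected.\<close>

definition act :: "nat \<Rightarrow> (nat \<Rightarrow> nat \<Rightarrow> int) \<Rightarrow> (nat \<Rightarrow> nat \<Rightarrow> int) \<Rightarrow> nat \<Rightarrow> nat \<Rightarrow> int" where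
  "act k A g i n = (\<Sum>j\<le>k. A i j * g j n)"

text \<open>Restricted to \<open>[0, N)\<close>, only finitely many k-tuples satisfy this bound;
  hence it measures what a finite set of translates can cover.\<close>

definition block_le :: "nat \<Rightarrow> (nat \<Rightarrow> nat \<Rightarrow> int) \<Rightarrow> nat \<Rightarrow> nat \<Rightarrow> bool" where
  "block_le k x N B \<longleftrightarrow> (\<forall>i<k. \<forall>n<N. \<bar>x i n\<bar> \<le> int B)"

text \<open>An enumeration of all integer matrices through the countable type of lists of lists. The
  code \<open>l\<close> matches matrices with the sets \<open>I l\<close>; entries outside the lists
  are unspecified.\<close>

definition decode_matrix :: "nat \<Rightarrow> nat \<Rightarrow> nat \<Rightarrow> int" where
  "decode_matrix l i j = (from_nat l :: int list list) ! i ! j"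

lemma decode_matrix_surj: "\<exists>l. \<forall>i<k. \<forall>j\<le>k. decode_matrix l i j = A i j"
  by (rule exI[of _ "to_nat (map (\<lambda>i. map (A i) [0..<Suc k]) [0..<k])"])
    (simp add: decode_matrix_def del: upt_Suc)

text \<open>
  Let \<open>h\<close> escape the functions \<open>u \<mapsto> \<Theta> u + H (next element of N after u)\<close> and, on the segments
  \<open>[h s, h (s + 1))\<close> with \<open>s \<in> I l\<close>, let \<open>g\<close> be a large multiple of a kernel vector of the \<open>l\<close>-th
  matrix \<open>A\<close>. If \<open>n\<close> and \<open>n + 1\<close> are good indices in \<open>I l\<close>, then \<open>A g\<close> vanishes on
  \<open>[h n, h (n + 2))\<close>, it is at most \<open>\<Theta> (h n) < h (n + 1)\<close> before, and some \<open>m \<in> N\<close> satisfies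
  \<open>h (n + 1) \<le> m\<close> and \<open>H m < h (n + 2)\<close>.
\<close>

lemma one_step:
  fixes Z :: "(nat set \<times> (nat \<Rightarrow> nat)) set" and d :: "nat \<Rightarrow> nat"
  assumes I: "admissible_partition I"
    and Z: "|Z| <o cardinal_d' I" "\<forall>z\<in>Z. infinite (fst z)"
  shows "\<exists>g. (\<forall>n. \<exists>j\<le>k. int (d n) < \<bar>g j n\<bar>) \<and>
    (\<forall>N H A. (N, H) \<in> Z \<longrightarrow> (\<exists>\<^sub>\<infinity>m. m \<in> N \<and> block_le k (act k A g) (H m) m))"
proof -
  have "\<exists>v. (\<exists>j\<le>k. v j \<noteq> 0) \<and> (\<forall>i<k. (\<Sum>j\<le>k. decode_matrix l i j * v j) = 0)" for l
    using kernel_vector[of "{..k}" k "decode_matrix l"] by auto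
  then obtain v where v: "\<And>l. \<exists>j\<le>k. v l j \<noteq> 0"
      "\<And>l i. i < k \<Longrightarrow> (\<Sum>j\<le>k. decode_matrix l i j * v l j) = 0"
    by metis
  have "\<exists>l. n \<in> I l" for n
    using I unfolding admissible_partition_def by blast
  then obtain lab where lab: "\<And>n. n \<in> I (lab n)"
    by metis
  have lab_eq: "lab n = l" if "n \<in> I l" for n l
    using I lab[of n] that unfolding admissible_partition_def disjoint_family_on_def by blast

  \<comment> \<open>A nondecreasing majorant strictly above \<open>d\<close>, so that one value at
    the right end of a segment serves the whole segment.\<close>
  define dd where "dd u = Suc (\<Sum>i\<le>u. d i)" for u
  have dd_mono: "dd a \<le> dd b" if "a \<le> b" for a b
    using that by (auto simp: dd_def intro!: sum_mono2)
  have dd_gt: "d a < dd b" if "a \<le> b" for a b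
    using that member_le_sum[of a "{..b}" d] by (simp add: dd_def)
  define V where "V n = (\<Sum>s\<le>n. \<Sum>j\<le>k. nat \<bar>v (lab s) j\<bar>)" for n
  have V_mono: "V a \<le> V b" if "a \<le> b" for a b
    using that by (auto simp: V_def intro!: sum_mono2)
  have V_ge: "nat \<bar>v (lab s) j\<bar> \<le> V n" if "s \<le> n" "j \<le> k" for s n j
  proof -
    have "nat \<bar>v (lab s) j\<bar> \<le> (\<Sum>j\<le>k. nat \<bar>v (lab s) j\<bar>)"
      by (rule member_le_sum) (use that in auto)
    also have "\<dots> \<le> V n"
      unfolding V_def by (rule member_le_sum) (use that in auto)
    finally show ?thesis .
  qed
  \<comment> \<open>The three factors will bound the size of the matrix, the entries of the kernel
    vectors used so far, and their multipliers.\<close>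
  define \<Theta> where "\<Theta> u = u * V u * dd u" for u
  define nxt where "nxt N u = (LEAST m. m \<in> N \<and> u \<le> m)" for N and u :: nat
  \<comment> \<open>One function for both purposes: escaping it at \<open>n\<close> controls the
    values of \<open>A g\<close> before \<open>h n\<close>, and escaping it at \<open>n + 1\<close>
    keeps \<open>H m\<close> within the next segment.\<close>
  define \<phi> where "\<phi> = (\<lambda>(N, H) u. \<Theta> u + H (nxt N u))"

  have "|\<phi> ` Z| <o cardinal_d' I"
    using card_of_image Z(1) by (rule ordLeq_ordLess_trans)
  then obtain h where h: "strict_mono h"
    and esc: "\<And>f l. f \<in> \<phi> ` Z \<Longrightarrow>
      \<exists>\<^sub>\<infinity>n. n \<in> I l \<inter> [f \<lless> h] \<and> n + 1 \<in> I l \<inter> [f \<lless> h]"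
    using small_escapable by blast
  have h_ge: "n \<le> h n" for n
    using h by (rule strict_mono_imp_increasing)
  have h_le: "h a \<le> h b" if "a \<le> b" for a b
    using h that by (simp add: strict_mono_less_eq)
  \<comment> \<open>The segment containing \<open>i\<close>. Positions below \<open>h 0\<close> are
    counted in segment 0.\<close>
  define s where "s i = (LEAST s. i < h (Suc s))" for i
  have s1: "i < h (Suc (s i))" for i
    unfolding s_def by (rule LeastI[of _ i]) (meson Suc_le_eq h_ge)
  have s2: "h (Suc t) \<le> i" if "t < s i" for t i
    using that not_less_Least unfolding s_def by (metis not_le)
  \<comment> \<open>The multiplier is constant on each segment, so kernel relations persist; some
    entry of the kernel vector is a nonzero integer, so its multiple exceeds
    \<open>d\<close>.\<close>
  define g where "g j i = v (lab (s i)) j * int (dd (h (Suc (s i))))" for j i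

  have "\<exists>j\<le>k. int (d n) < \<bar>g j n\<bar>" for n
  proof -
    obtain j where j: "j \<le> k" "v (lab (s n)) j \<noteq> 0"
      using v(1) by blast
    have "int (d n) < int (dd (h (Suc (s n))))"
      using dd_gt[of n "h (Suc (s n))"] s1[of n] by simp
    also have "\<dots> \<le> \<bar>g j n\<bar>"
      using j(2) mult_right_mono[of 1 "\<bar>v (lab (s n)) j\<bar>" "int (dd (h (Suc (s n))))"]
      unfolding g_def abs_mult by linarith
    finally show ?thesis
      using j(1) by blast
  qed
  moreover have "\<exists>\<^sub>\<infinity>m. m \<in> N \<and> block_le k (act k A g) (H m) m" if NH: "(N, H) \<in> Z" for N H A
    unfolding INFM_nat_le
  proof
    fix M
    obtain l where l: "\<And>i j. i < k \<Longrightarrow> j \<le> k \<Longrightarrow> decode_matrix l i j = A i j"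
      using decode_matrix_surj[of k A] by blast
    \<comment> \<open>Once \<open>n \<ge> a\<close>, the factor \<open>h n\<close> in
      \<open>\<Theta> (h n)\<close> absorbs the absolute row sums of \<open>A\<close>.\<close>
    define a where "a = (\<Sum>i<k. \<Sum>j\<le>k. nat \<bar>A i j\<bar>)"
    have a: "(\<Sum>j\<le>k. nat \<bar>A i j\<bar>) \<le> a" if "i < k" for i
      unfolding a_def by (rule member_le_sum) (use that in auto)
    have "\<phi> (N, H) \<in> \<phi> ` Z"
      using NH by (rule imageI)
    from esc[OF this, of l, unfolded INFM_nat_le, rule_format, of "max M a"]
    obtain n where n: "max M a \<le> n" "n \<in> I l" "Suc n \<in> I l"
      "\<phi> (N, H) (h n) < h (Suc n)" "\<phi> (N, H) (h (Suc n)) < h (Suc (Suc n))"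
      by (auto simp: much_less_def)
    define m where "m = nxt N (h (Suc n))"
    have "infinite N"
      using Z(2) NH by force
    then have "\<exists>m. m \<in> N \<and> h (Suc n) \<le> m"
      unfolding infinite_nat_iff_unbounded_le by blast
    then have m: "m \<in> N" "h (Suc n) \<le> m"
      unfolding m_def nxt_def by (metis (mono_tags, lifting) LeastI_ex)+
    have H: "H m < h (Suc (Suc n))" and \<Theta>: "\<Theta> (h n) \<le> m"
      using n(4,5) m(2) by (auto simp: \<phi>_def m_def)
    have "M \<le> m"
      using n(1) h_ge[of n] h_le[of n "Suc n"] m(2) by linarith
    moreover have "block_le k (act k A g) (H m) m"
      unfolding block_le_def
    proof (intro allI impI)
      fix i p
      assume i: "i < k" and p: "p < H m"
      show "\<bar>act k A g i p\<bar> \<le> int m"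
      proof (cases "s p < n")
        case True
        have g: "\<bar>g j p\<bar> \<le> int (V n * dd (h n))" if "j \<le> k" for j
        proof -
          have "\<bar>v (lab (s p)) j\<bar> \<le> int (V n)"
            using V_ge[of "s p" n j] True that by simp
          moreover have "int (dd (h (Suc (s p)))) \<le> int (dd (h n))"
            using True by (simp add: dd_mono h_le)
          ultimately show ?thesis
            by (simp add: g_def abs_mult mult_mono)
        qed
        have "\<bar>act k A g i p\<bar> \<le> (\<Sum>j\<le>k. \<bar>A i j\<bar> * \<bar>g j p\<bar>)"
          unfolding act_def by (rule order_trans[OF sum_abs]) (simp add: abs_mult)
        also have "\<dots> \<le> (\<Sum>j\<le>k. \<bar>A i j\<bar> * int (V n * dd (h n)))"
          by (intro sum_mono mult_left_mono g) auto
        also have "\<dots> = int ((\<Sum>j\<le>k. nat \<bar>A i j\<bar>) * (V n * dd (h n)))"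
          by (simp add: sum_distrib_right)
        also have "\<dots> \<le> int (h n * (V (h n) * dd (h n)))"
          using a[OF i] n(1) h_ge[of n]
          by (intro of_nat_mono mult_mono V_mono) auto
        also have "\<dots> \<le> int m"
          using \<Theta> unfolding \<Theta>_def mult.assoc by (rule of_nat_mono)
        finally show ?thesis .
      next
        case False
        \<comment> \<open>A later segment would start at or after \<open>h (n + 2)\<close>, beyond
          \<open>H m\<close>. So \<open>p\<close> lies in segment \<open>n\<close> or
          \<open>n + 1\<close>, both labelled \<open>l\<close>.\<close>
        have "s p \<le> Suc n"
          using s2[of "Suc n" p] p H by (meson leD le_less_trans less_imp_le not_le)
        then have "s p \<in> I l"
          using False n(2,3) by (metis le_SucE not_less order_antisym)
        then have "lab (s p) = l"
          by (rule lab_eq)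
        then have "act k A g i p = (\<Sum>j\<le>k. decode_matrix l i j * v l j) * int (dd (h (Suc (s p))))"
          using l[OF i] by (simp add: act_def g_def sum_distrib_right mult.assoc)
        then show ?thesis
          using v(2)[OF i] by simp
      qed
    qed
    ultimately show "\<exists>m\<ge>M. m \<in> N \<and> block_le k (act k A g) (H m) m"
      using m(1) by blast
  qed
  ultimately show ?thesis
    by blast
qed

section \<open>Powers of subgroups of the Baer-Specker group\<close>

lemma baer_specker_simps:
  "carrier baer_specker = UNIV"
  "x \<otimes>\<^bsub>baer_specker\<^esub> y = (\<lambda>n. x n + y n)"
  "\<one>\<^bsub>baer_specker\<^esub> = (\<lambda>_. 0)"
  by (auto simp: baer_specker_def)

lemma inv_baer_specker: "inv\<^bsub>baer_specker\<^esub> x = (\<lambda>n. - x n)"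
  unfolding baer_specker_def by (subst inv_product_group) (auto simp: PiE_UNIV_domain)

lemma subgroup_baer_specker_iff:
  "subgroup G baer_specker \<longleftrightarrow>
     (\<lambda>_. 0) \<in> G \<and> (\<forall>x\<in>G. \<forall>y\<in>G. (\<lambda>n. x n + y n) \<in> G) \<and> (\<forall>x\<in>G. (\<lambda>n. - x n) \<in> G)"
  by (auto simp: subgroup_def baer_specker_simps inv_baer_specker)

lemma bs_power_simps:
  "carrier (bs_power G k) = (\<Pi>\<^sub>E i\<in>{..<k}. G)"
  "x \<otimes>\<^bsub>bs_power G k\<^esub> y = (\<lambda>i\<in>{..<k}. \<lambda>n. x i n + y i n)"
  "\<one>\<^bsub>bs_power G k\<^esub> = (\<lambda>i\<in>{..<k}. \<lambda>_. 0)"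
  by (auto simp: bs_power_def baer_specker_simps)

lemma topspace_baer_specker_top: "topspace baer_specker_top = UNIV"
  by (simp add: baer_specker_top_def PiE_UNIV_domain)

lemma topspace_bs_power_top: "topspace (bs_power_top G k) = (\<Pi>\<^sub>E i\<in>{..<k}. G)"
  by (simp add: bs_power_top_def topspace_baer_specker_top)

lemma openin_baer_specker_top_zero:
  assumes "openin baer_specker_top W" "(\<lambda>_. 0) \<in> W"
  shows "\<exists>N. \<forall>y. (\<forall>n<N. y n = 0) \<longrightarrow> y \<in> W"
proof -
  obtain U where U: "finite {n. U n \<noteq> (UNIV :: int set)}" "(\<lambda>_. 0) \<in> Pi\<^sub>E UNIV U" "Pi\<^sub>E UNIV U \<subseteq> W"
    using assms unfolding baer_specker_top_def openin_product_topology_alt by fastforce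
  obtain N where N: "\<And>n. U n \<noteq> UNIV \<Longrightarrow> n < N"
    using U(1) unfolding finite_nat_set_iff_bounded by auto
  have "y \<in> W" if "\<forall>n<N. y n = 0" for y
  proof -
    have "y n \<in> U n" for n
      using that N[of n] U(2) by (cases "n < N") (auto simp: PiE_UNIV_domain Pi_iff)
    then show ?thesis
      using U(3) by (auto simp: PiE_UNIV_domain Pi_iff)
  qed
  then show ?thesis
    by blast
qed

lemma openin_baer_specker_top_cylinder: "openin baer_specker_top {y. \<forall>n<N. y n = 0}"
proof -
  have "{y. \<forall>n<N. y n = (0 :: int)} = (\<Pi>\<^sub>E n\<in>UNIV. if n < N then {0} else UNIV)"
    by (auto simp: PiE_UNIV_domain Pi_iff split: if_splits)
  moreover have "finite {n. (if n < N then {0 :: int} else UNIV) \<noteq> UNIV}"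
    by (rule finite_subset[of _ "{..<N}"]) auto
  ultimately show ?thesis
    unfolding baer_specker_top_def by (simp add: openin_PiE_gen)
qed

lemma unit_nbhd_bs_powerD:
  assumes "unit_nbhd (bs_power G k) (bs_power_top G k) U"
  shows "U \<subseteq> (\<Pi>\<^sub>E i\<in>{..<k}. G)"
    and "\<exists>N. \<forall>x \<in> \<Pi>\<^sub>E i\<in>{..<k}. G. (\<forall>i<k. \<forall>n<N. x i n = 0) \<longrightarrow> x \<in> U"
proof -
  obtain V where V: "openin (bs_power_top G k) V" "(\<lambda>i\<in>{..<k}. \<lambda>_. 0) \<in> V" "V \<subseteq> U"
    using assms by (auto simp: unit_nbhd_def bs_power_simps)
  obtain W where W: "\<And>i. i < k \<Longrightarrow> openin (subtopology baer_specker_top G) (W i)"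
    "(\<lambda>i\<in>{..<k}. \<lambda>_. 0) \<in> Pi\<^sub>E {..<k} W" "Pi\<^sub>E {..<k} W \<subseteq> V"
    using V(1)[unfolded bs_power_top_def openin_product_topology_alt, rule_format, OF V(2)] by auto
  have "\<exists>N. \<forall>y\<in>G. (\<forall>n<N. y n = 0) \<longrightarrow> y \<in> W i" if i: "i < k" for i
  proof -
    obtain T where "openin baer_specker_top T" "W i = T \<inter> G"
      using W(1)[OF i] by (auto simp: openin_subtopology)
    moreover have "(\<lambda>_. 0) \<in> W i"
      using W(2) i by (auto simp: PiE_iff)
    ultimately show ?thesis
      using openin_baer_specker_top_zero[of T] by blast
  qed
  then obtain N where N: "\<And>i y. i < k \<Longrightarrow> y \<in> G \<Longrightarrow> \<forall>n<N i. y n = 0 \<Longrightarrow> y \<in> W i"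
    by metis
  \<comment> \<open>The sum of the \<open>N i\<close> is a common bound for all \<open>k\<close>
    coordinates.\<close>
  have "x \<in> U" if x: "x \<in> (\<Pi>\<^sub>E i\<in>{..<k}. G)" "\<forall>i<k. \<forall>n<(\<Sum>i<k. N i). x i n = 0" for x
  proof -
    have "x i \<in> W i" if "i < k" for i
    proof (rule N[OF that])
      have "N i \<le> (\<Sum>i<k. N i)"
        by (rule member_le_sum) (use that in auto)
      then show "\<forall>n<N i. x i n = 0"
        using x(2) that by auto
    qed (use x(1) that in auto)
    then have "x \<in> Pi\<^sub>E {..<k} W"
      using x(1) by (auto simp: PiE_iff)
    then show ?thesis
      using W(3) V(3) by blast
  qed
  then show "\<exists>N. \<forall>x \<in> \<Pi>\<^sub>E i\<in>{..<k}. G. (\<forall>i<k. \<forall>n<N. x i n = 0) \<longrightarrow> x \<in> U"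
    by blast
  show "U \<subseteq> (\<Pi>\<^sub>E i\<in>{..<k}. G)"
    using assms by (simp add: unit_nbhd_def topspace_bs_power_top)
qed

lemma unit_nbhd_bs_power_cylinder:
  assumes "(\<lambda>_. 0) \<in> G"
  shows "unit_nbhd (bs_power G k) (bs_power_top G k)
    {x \<in> \<Pi>\<^sub>E i\<in>{..<k}. G. \<forall>i<k. \<forall>n<N. x i n = 0}"
    (is "unit_nbhd _ _ ?U")
proof -
  have U: "?U = (\<Pi>\<^sub>E i\<in>{..<k}. {y. \<forall>n<N. y n = 0} \<inter> G)"
    by (rule Set.set_eqI) (simp add: PiE_iff; blast)
  have "openin (subtopology baer_specker_top G) ({y. \<forall>n<N. y n = 0} \<inter> G)"
    using openin_baer_specker_top_cylinder unfolding openin_subtopology by blast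
  then have "openin (bs_power_top G k) ?U"
    unfolding U bs_power_top_def by (simp add: openin_PiE)
  moreover have "\<one>\<^bsub>bs_power G k\<^esub> \<in> ?U"
    using assms by (auto simp: bs_power_simps)
  ultimately show ?thesis
    unfolding unit_nbhd_def topspace_bs_power_top by blast
qed

text \<open>The n-th neighbourhood contains all tuples vanishing on \<open>[0, H n)\<close>. The
  tuples bounded by \<open>F m\<close> on \<open>[0, H m)\<close> have finitely many restrictions to
  it; one representative of each suffices, since tuples with equal restrictions differ by an element
  of the neighbourhood.\<close>

lemma menger_bounded_bs_powerI:
  assumes G: "subgroup G baer_specker"
    and bound: "\<And>H :: nat \<Rightarrow> nat. \<exists>F. \<forall>x. (\<forall>i<k. x i \<in> G) \<longrightarrow> (\<exists>m. block_le k x (H m) (F m))"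
  shows "menger_bounded (bs_power G k) (bs_power_top G k)"
  unfolding menger_bounded_def
proof (intro allI impI)
  fix U :: "nat \<Rightarrow> (nat \<Rightarrow> nat \<Rightarrow> int) set"
  assume U: "\<forall>n. unit_nbhd (bs_power G k) (bs_power_top G k) (U n)"
  let ?C = "\<Pi>\<^sub>E i\<in>{..<k}. G"
  have sub: "U n \<subseteq> ?C" for n
    using U unit_nbhd_bs_powerD(1) by blast
  have "\<forall>n. \<exists>N. \<forall>x \<in> ?C. (\<forall>i<k. \<forall>p<N. x i p = 0) \<longrightarrow> x \<in> U n"
    using U unit_nbhd_bs_powerD(2) by blast
  then obtain H where H: "\<And>n x. x \<in> ?C \<Longrightarrow> \<forall>i<k. \<forall>p<H n. x i p = 0 \<Longrightarrow> x \<in> U n"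
    by metis
  obtain F where F: "\<And>x. \<forall>i<k. x i \<in> G \<Longrightarrow> \<exists>m. block_le k x (H m) (F m)"
    using bound[of H] by blast
  define B where "B m = {x \<in> ?C. block_le k x (H m) (F m)}" for m
  define \<rho> :: "nat \<Rightarrow> (nat \<Rightarrow> nat \<Rightarrow> int) \<Rightarrow> nat \<Rightarrow> nat \<Rightarrow> int"
    where "\<rho> m x = (\<lambda>i\<in>{..<k}. \<lambda>p\<in>{..<H m}. x i p)" for m x
  \<comment> \<open>Representatives are taken inside \<open>B m\<close>, so that they belong to the
    power of \<open>G\<close>.\<close>
  have "\<exists>R\<subseteq>B m. finite R \<and> \<rho> m ` B m = \<rho> m ` R" for m
  proof (rule finite_subset_image)
    have "\<rho> m ` B m \<subseteq> (\<Pi>\<^sub>E i\<in>{..<k}. \<Pi>\<^sub>E p\<in>{..<H m}. {- int (F m)..int (F m)})"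
      by (fastforce simp: \<rho>_def B_def block_le_def abs_le_iff)
    then show "finite (\<rho> m ` B m)"
      by (rule finite_subset) (intro finite_PiE; simp)
  qed simp
  then obtain R where R: "\<And>m. R m \<subseteq> B m" "\<And>m. finite (R m)" "\<And>m. \<rho> m ` B m = \<rho> m ` R m"
    by metis
  have cl: "(\<lambda>_. 0) \<in> G" "\<And>x y. x \<in> G \<Longrightarrow> y \<in> G \<Longrightarrow> (\<lambda>n. x n + y n) \<in> G"
      "\<And>x. x \<in> G \<Longrightarrow> (\<lambda>n. - x n) \<in> G"
    using G by (auto simp: subgroup_baer_specker_iff)
  have eq: "?C = (\<Union>n. R n <#>\<^bsub>bs_power G k\<^esub> U n)"
  proof (intro equalityI subsetI)
    fix x
    assume x: "x \<in> ?C"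
    then obtain m where m: "block_le k x (H m) (F m)"
      using F[of x] by (auto simp: PiE_iff)
    then have "x \<in> B m"
      using x by (simp add: B_def)
    then obtain y where y: "y \<in> R m" "\<rho> m x = \<rho> m y"
      using R(3)[of m] by blast
    then have yC: "y \<in> ?C"
      using R(1)[of m] by (auto simp: B_def)
    define u where "u = (\<lambda>i\<in>{..<k}. \<lambda>n. x i n + - y i n)"
    have "u \<in> U m"
    proof (rule H)
      have "(\<lambda>n. x i n + - y i n) \<in> G" if "i < k" for i
        using cl(2)[OF _ cl(3), of "x i" "y i"] PiE_mem[OF x] PiE_mem[OF yC] that by simp
      then show "u \<in> ?C"
        unfolding u_def by (intro restrict_PiE_iff[THEN iffD2]) simp
      have "x i p = y i p" if "i < k" "p < H m" for i p
        using fun_cong[OF fun_cong[OF y(2), of i], of p] that by (simp add: \<rho>_def)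
      then show "\<forall>i<k. \<forall>p<H m. u i p = 0"
        by (simp add: u_def)
    qed
    moreover have "x = y \<otimes>\<^bsub>bs_power G k\<^esub> u"
      using x by (intro ext) (auto simp: bs_power_simps u_def PiE_iff extensional_def)
    ultimately show "x \<in> (\<Union>n. R n <#>\<^bsub>bs_power G k\<^esub> U n)"
      using y(1) by (auto simp: set_mult_def)
  next
    fix x
    assume "x \<in> (\<Union>n. R n <#>\<^bsub>bs_power G k\<^esub> U n)"
    then obtain n y u where "y \<in> R n" "u \<in> U n" and x: "x = y \<otimes>\<^bsub>bs_power G k\<^esub> u"
      by (auto simp: set_mult_def)
    then have yu: "y \<in> ?C" "u \<in> ?C"
      using R(1)[of n] sub by (auto simp: B_def)
    have "(\<lambda>n. y i n + u i n) \<in> G" if "i < k" for i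
      using cl(2)[of "y i" "u i"] PiE_mem[OF yu(1)] PiE_mem[OF yu(2)] that by simp
    then show "x \<in> ?C"
      unfolding x bs_power_simps by (intro restrict_PiE_iff[THEN iffD2]) simp
  qed
  show "\<exists>F. (\<forall>n. finite (F n) \<and> F n \<subseteq> carrier (bs_power G k)) \<and>
      carrier (bs_power G k) = (\<Union>n. F n <#>\<^bsub>bs_power G k\<^esub> U n)"
    unfolding bs_power_simps(1)
  proof (intro exI[of _ R] conjI allI)
    show "R n \<subseteq> ?C" for n
      using R(1)[of n] by (auto simp: B_def)
    show "?C = (\<Union>n. R n <#>\<^bsub>bs_power G k\<^esub> U n)"
      by (rule eq)
  qed (rule R(2))
qed

text \<open>For suitable neighbourhoods, a tuple in \<open>F n + U n\<close> agrees at position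
  \<open>n\<close> with a member of the finite set \<open>F n\<close>, hence is bounded there by
  \<open>f n\<close>. A tuple exceeding \<open>f\<close> at every position is never covered.\<close>

lemma not_menger_bounded_bs_powerI:
  assumes G: "subgroup G baer_specker"
    and large: "\<And>f. \<exists>x. (\<forall>i<k. x i \<in> G) \<and> (\<forall>n. \<exists>i<k. int (f n) < \<bar>x i n\<bar>)"
  shows "\<not> menger_bounded (bs_power G k) (bs_power_top G k)"
proof
  assume menger: "menger_bounded (bs_power G k) (bs_power_top G k)"
  \<comment> \<open>\<open>Suc n\<close> rather than \<open>n\<close>, so that position
    \<open>n\<close> itself is fixed.\<close>
  define U where "U n = {x \<in> \<Pi>\<^sub>E i\<in>{..<k}. G. \<forall>i<k. \<forall>p<Suc n. x i p = 0}" for n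
  have "unit_nbhd (bs_power G k) (bs_power_top G k) (U n)" for n
    unfolding U_def using G by (intro unit_nbhd_bs_power_cylinder) (simp add: subgroup_baer_specker_iff)
  then obtain F where F: "\<And>n. finite (F n)"
      "(\<Pi>\<^sub>E i\<in>{..<k}. G) = (\<Union>n. F n <#>\<^bsub>bs_power G k\<^esub> U n)"
    using menger unfolding menger_bounded_def bs_power_simps(1) by metis
  define f where "f n = (\<Sum>y\<in>F n. \<Sum>i<k. nat \<bar>y i n\<bar>)" for n
  obtain x where x: "\<And>i. i < k \<Longrightarrow> x i \<in> G" "\<And>n. \<exists>i<k. int (f n) < \<bar>x i n\<bar>"
    using large[of f] by blast
  have "(\<lambda>i\<in>{..<k}. x i) \<in> (\<Pi>\<^sub>E i\<in>{..<k}. G)"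
    using x(1) by auto
  then obtain n y u where y: "y \<in> F n" and u: "u \<in> U n"
    and eq: "(\<lambda>i\<in>{..<k}. x i) = y \<otimes>\<^bsub>bs_power G k\<^esub> u"
    unfolding F(2) by (auto simp: set_mult_def)
  obtain i where i: "i < k" "int (f n) < \<bar>x i n\<bar>"
    using x(2) by blast
  have "x i n = y i n"
    using fun_cong[OF fun_cong[OF eq, of i], of n] i(1) u by (simp add: bs_power_simps U_def)
  moreover have "nat \<bar>y i n\<bar> \<le> f n"
  proof -
    have "nat \<bar>y i n\<bar> \<le> (\<Sum>i<k. nat \<bar>y i n\<bar>)"
      by (rule member_le_sum) (use i(1) in auto)
    also have "\<dots> \<le> f n"
      unfolding f_def by (rule member_le_sum[of y "F n" "\<lambda>y. \<Sum>i<k. nat \<bar>y i n\<bar>"]) (use y F(1) in auto)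
    finally show ?thesis .
  qed
  ultimately show False
    using i(2) by linarith
qed

section \<open>The recursive construction\<close>

text \<open>The strict part of the cardinal order \<open>|D|\<close>: proper initial segments of an
  initial ordinal have smaller cardinality.\<close>

lemma small_initial_segments:
  fixes D :: "'a set"
  obtains R where "wf R" "trans R" "total_on D R" "R \<subseteq> D \<times> D"
    "\<And>d. d \<in> D \<Longrightarrow> |{e. (e, d) \<in> R}| <o |D|"
proof (rule that[of "|D| - Id"])
  have wo: "well_order_on D |D|"
    by (rule card_of_well_order_on)
  show "wf ( |D| - Id)"
    using wo by (simp add: well_order_on_def)
  have "trans |D|" "antisym |D|"
    using wo by (auto simp: order_on_defs)
  then show "trans ( |D| - Id)"
    by (rule trans_diff_Id)
  show "total_on D ( |D| - Id)"
    using wo by (auto simp: order_on_defs total_on_def)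
  show "|D| - Id \<subseteq> D \<times> D"
    using wo by (auto simp: order_on_defs refl_on_def Field_def)
  show "|{e. (e, d) \<in> |D| - Id}| <o |D|" if "d \<in> D" for d
  proof -
    have "underS |D| d = {e. (e, d) \<in> |D| - Id}"
      by (auto simp: underS_def)
    then show ?thesis
      using card_of_underS[OF card_of_Card_order, of d D] that by (simp add: Field_card_of)
  qed
qed

lemma finite_total_max:
  assumes "finite E" "E \<noteq> {}" "trans R" "total_on E R"
  obtains d where "d \<in> E" "\<And>e. e \<in> E \<Longrightarrow> e \<noteq> d \<Longrightarrow> (e, d) \<in> R"
proof -
  have "\<exists>d\<in>E. \<forall>e\<in>E. e \<noteq> d \<longrightarrow> (e, d) \<in> R"
    using assms
  proof (induction E rule: finite_ne_induct)
    case (insert a E)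
    then obtain d where d: "d \<in> E" "\<forall>e\<in>E. e \<noteq> d \<longrightarrow> (e, d) \<in> R"
      by (auto simp: total_on_def)
    have "(a, d) \<in> R \<or> (d, a) \<in> R"
      using insert.prems insert.hyps d(1) by (auto simp: total_on_def)
    then show ?case
    proof
      assume "(d, a) \<in> R"
      then have "\<forall>e\<in>E. (e, a) \<in> R"
        using d(2) \<open>trans R\<close> by (metis transD)
      then show ?case
        by auto
    qed (use d in auto)
  qed auto
  then show thesis
    using that by blast
qed

section \<open>Matrix combinations of generators and functions catching them\<close>

text \<open>k-tuples over the generated group are presented with one matrix per generator tuple, the
  form to which \<open>one_step\<close> applies.\<close>

definition lincombs :: "nat \<Rightarrow> ('b \<Rightarrow> nat \<Rightarrow> nat \<Rightarrow> int) \<Rightarrow> 'b set \<Rightarrow> (nat \<Rightarrow> nat \<Rightarrow> int) set" where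
  "lincombs k g S = {\<lambda>i n. \<Sum>e\<in>E. act k (A e) (g e) i n | E A. finite E \<and> E \<subseteq> S}"

lemma lincombsI:
  assumes "finite E" "E \<subseteq> S"
  shows "(\<lambda>i n. \<Sum>e\<in>E. act k (A e) (g e) i n) \<in> lincombs k g S"
  using assms unfolding lincombs_def by blast

lemma lincombs_cong:
  assumes "\<And>e. e \<in> S \<Longrightarrow> g e = g' e"
  shows "lincombs k g S = lincombs k g' S"
proof -
  have "lincombs k g S \<subseteq> lincombs k g' S" if "\<And>e. e \<in> S \<Longrightarrow> g e = g' e" for g g'
  proof
    fix x
    assume "x \<in> lincombs k g S"
    then obtain E A where E: "finite E" "E \<subseteq> S" "x = (\<lambda>i n. \<Sum>e\<in>E. act k (A e) (g e) i n)"
      unfolding lincombs_def by blast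
    then have "x = (\<lambda>i n. \<Sum>e\<in>E. act k (A e) (g' e) i n)"
      using that by (auto intro!: ext sum.cong)
    then show "x \<in> lincombs k g' S"
      using E(1,2) lincombsI by blast
  qed
  from this[of g g'] this[of g' g] show ?thesis
    using assms by auto
qed

text \<open>On the rows \<open>i < k\<close> a combination is determined by a finite list of
  generators and matrix codes. The set \<open>X\<close> of representatives is needed because the
  rows \<open>i \<ge> k\<close> are arbitrary and can make \<open>lincombs\<close> itself
  large.\<close>

lemma lincombs_small:
  assumes D: "|UNIV :: nat set| <o |D|" and S: "|S| <o |D|"
  obtains X where "|X| <o |D|" "\<And>x. x \<in> lincombs k g S \<Longrightarrow> \<exists>y\<in>X. \<forall>i<k. y i = x i"
proof -
  define comb where
    "comb xs i n = (\<Sum>(e, l)\<leftarrow>xs. act k (decode_matrix l) (g e) i n)" for xs :: "('b \<times> nat) list" and i n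
  define X where "X = comb ` lists (S \<times> UNIV)"
  have "|X| \<le>o |lists (S \<times> (UNIV :: nat set))|"
    unfolding X_def by (rule card_of_image)
  moreover have "|lists (S \<times> (UNIV :: nat set))| <o |D|"
    by (intro lists_ordLess Times_ordLess assms)
  ultimately have "|X| <o |D|"
    by (rule ordLeq_ordLess_trans)
  moreover have "\<exists>y\<in>X. \<forall>i<k. y i = x i" if x: "x \<in> lincombs k g S" for x
  proof -
    obtain E A where E: "finite E" "E \<subseteq> S" "x = (\<lambda>i n. \<Sum>e\<in>E. act k (A e) (g e) i n)"
      using x unfolding lincombs_def by blast
    have "\<exists>xs\<in>lists (S \<times> UNIV). \<forall>i<k. comb xs i = (\<lambda>n. \<Sum>e\<in>E. act k (A e) (g e) i n)"
      using E(1,2)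
    proof (induction E)
      case empty
      show ?case
        by (intro bexI[of _ "[]"]) (auto simp: comb_def)
    next
      case (insert d E)
      then obtain xs where xs: "xs \<in> lists (S \<times> UNIV)"
        "\<forall>i<k. comb xs i = (\<lambda>n. \<Sum>e\<in>E. act k (A e) (g e) i n)"
        by auto
      obtain l where l: "\<forall>i<k. \<forall>j\<le>k. decode_matrix l i j = A d i j"
        using decode_matrix_surj by blast
      have "comb ((d, l) # xs) i = (\<lambda>n. \<Sum>e\<in>insert d E. act k (A e) (g e) i n)" if "i < k" for i
      proof
        fix n
        have "comb ((d, l) # xs) i n = act k (decode_matrix l) (g d) i n + comb xs i n"
          by (simp add: comb_def)
        also have "\<dots> = act k (A d) (g d) i n + (\<Sum>e\<in>E. act k (A e) (g e) i n)"
          using xs(2) l that by (simp add: act_def)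
        finally show "comb ((d, l) # xs) i n = (\<Sum>e\<in>insert d E. act k (A e) (g e) i n)"
          using insert.hyps by simp
      qed
      then show ?case
        using xs(1) insert.prems by (intro bexI[of _ "(d, l) # xs"]) auto
    qed
    then show ?thesis
      unfolding X_def E(3) by auto
  qed
  ultimately show thesis
    by (rule that)
qed

text \<open>
  Meaningful only if the span of \<open>g ` S\<close> has cardinality below \<open>cardinal_d\<close>: then some function is
  not dominated by the sizes of the \<open>k\<close>-tuples of the span.
\<close>

definition catcher ::
  "nat \<Rightarrow> ('b \<Rightarrow> nat \<Rightarrow> nat \<Rightarrow> int) \<Rightarrow> 'b set \<Rightarrow> (nat \<Rightarrow> nat) \<Rightarrow> nat \<Rightarrow> nat" where
  "catcher k g S H =
    (SOME f. (\<forall>m. m \<le> f m) \<and> (\<forall>x\<in>lincombs k g S. \<exists>\<^sub>\<infinity>m. block_le k x (H m) (f m)))"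

lemma block_le_cong:
  assumes "\<And>i. i < k \<Longrightarrow> x i = y i"
  shows "block_le k x N B \<longleftrightarrow> block_le k y N B"
  using assms by (simp add: block_le_def)

lemma block_le_mono:
  assumes "block_le k x N B" "N' \<le> N" "B \<le> B'"
  shows "block_le k x N' B'"
  unfolding block_le_def
proof (intro allI impI)
  fix i n
  assume "i < k" "n < N'"
  then have "\<bar>x i n\<bar> \<le> int B"
    using assms(1,2) by (simp add: block_le_def)
  then show "\<bar>x i n\<bar> \<le> int B'"
    using assms(3) by linarith
qed

text \<open>The sizes of fewer than d representatives on the blocks \<open>[0, H m)\<close> do not
  form a dominating family, so some function exceeds each of them infinitely often.\<close>

lemma catcher:
  assumes D: "|D| =o cardinal_d" "|UNIV :: nat set| <o |D|" and S: "|S| <o |D|"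
  shows "m \<le> catcher k g S H m"
    and "x \<in> lincombs k g S \<Longrightarrow> \<exists>\<^sub>\<infinity>m. block_le k x (H m) (catcher k g S H m)"
proof -
  obtain X where X: "|X| <o |D|" "\<And>x. x \<in> lincombs k g S \<Longrightarrow> \<exists>y\<in>X. \<forall>i<k. y i = x i"
    using lincombs_small[OF D(2) S] by blast
  define size where "size y m = (\<Sum>i<k. \<Sum>n<H m. nat \<bar>y i n\<bar>)" for y :: "nat \<Rightarrow> nat \<Rightarrow> int" and m
  have size: "block_le k y (H m) (size y m)" for y m
    unfolding block_le_def
  proof (intro allI impI)
    fix i n
    assume "i < k" "n < H m"
    then have "nat \<bar>y i n\<bar> \<le> (\<Sum>n<H m. nat \<bar>y i n\<bar>)"
      by (intro member_le_sum) auto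
    also have "\<dots> \<le> size y m"
      unfolding size_def by (rule member_le_sum) (use \<open>i < k\<close> in auto)
    finally show "\<bar>y i n\<bar> \<le> int (size y m)"
      by linarith
  qed
  have "|size ` X| <o |D|"
    using card_of_image X(1) by (rule ordLeq_ordLess_trans)
  then have "|size ` X| <o cardinal_d"
    using D(1) by (rule ordLess_ordIso_trans)
  then obtain f where f: "\<forall>s\<in>size ` X. \<exists>\<^sub>\<infinity>n. s n < f n"
    using small_not_dominating by blast
  have "\<exists>f. (\<forall>m. m \<le> f m) \<and> (\<forall>x\<in>lincombs k g S. \<exists>\<^sub>\<infinity>m. block_le k x (H m) (f m))"
  \<comment> \<open>The maximum with \<open>m\<close> lets the catcher absorb later summands that
    are bounded by \<open>m\<close>.\<close>
  proof (intro exI[of _ "\<lambda>m. max m (f m)"] conjI ballI)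
    fix x
    assume "x \<in> lincombs k g S"
    then obtain y where y: "y \<in> X" "\<forall>i<k. y i = x i"
      using X(2) by blast
    then have "\<exists>\<^sub>\<infinity>m. size y m < f m"
      using f by blast
    then show "\<exists>\<^sub>\<infinity>m. block_le k x (H m) (max m (f m))"
    proof (rule INFM_mono)
      fix m
      assume "size y m < f m"
      then have "block_le k y (H m) (max m (f m))"
        using block_le_mono[OF size[of y m], of "H m" "max m (f m)"] by simp
      then show "block_le k x (H m) (max m (f m))"
        using y(2) block_le_cong by blast
    qed
  qed auto
  from someI_ex[OF this]
  show "m \<le> catcher k g S H m"
    and "x \<in> lincombs k g S \<Longrightarrow> \<exists>\<^sub>\<infinity>m. block_le k x (H m) (catcher k g S H m)"
    unfolding catcher_def by blast+
qed

text \<open>For the recursion: a catcher for the tuples built before a stage depends only on the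
  generators chosen before it.\<close>

lemma catcher_cong:
  assumes "\<And>e. e \<in> S \<Longrightarrow> g e = g' e"
  shows "catcher k g S = catcher k g' S"
proof -
  have "lincombs k g S = lincombs k g' S"
    by (rule lincombs_cong) (rule assms)
  then show ?thesis
    unfolding catcher_def by (simp only:)
qed

section \<open>Recursive choice of the generators\<close>

text \<open>Fewer than d' pairs of an earlier tuple and an earlier or current function must be
  respected at stage \<open>d\<close>, so \<open>one_step\<close> handles them all at once. It makes
  \<open>A q\<close> at most \<open>m\<close> at infinitely many \<open>m\<close> where the tuple
  was already caught, and \<open>m\<close> is at most the catcher; this raises \<open>c\<close> by
  one.\<close>

lemma generators:
  fixes D :: "(nat \<Rightarrow> nat) set"
  assumes I: "admissible_partition I" and D: "|D| =o cardinal_d" "|D| =o cardinal_d' I"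
    and unc: "|UNIV :: nat set| <o |D|"
    and R: "wf R" "trans R" "R \<subseteq> D \<times> D" "\<And>d. d \<in> D \<Longrightarrow> |{e. (e, d) \<in> R}| <o |D|"
  obtains g :: "(nat \<Rightarrow> nat) \<Rightarrow> nat \<Rightarrow> nat \<Rightarrow> int"
  where "\<And>d n. d \<in> D \<Longrightarrow> \<exists>j\<le>k. int (d n) < \<bar>g d j n\<bar>"
    and "\<And>d e x c A. \<lbrakk>d \<in> D; e = d \<or> (e, d) \<in> R; x \<in> lincombs k g {e. (e, d) \<in> R};
      \<exists>\<^sub>\<infinity>m. block_le k x (e m) (c * catcher k g {e'. (e', e) \<in> R} e m)\<rbrakk> \<Longrightarrow>
      \<exists>\<^sub>\<infinity>m. block_le k (\<lambda>i n. x i n + act k A (g d) i n) (e m)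
        (Suc c * catcher k g {e'. (e', e) \<in> R} e m)"
proof -
  define below where "below d = {e. (e, d) \<in> R}" for d
  define P where "P g d q \<longleftrightarrow> d \<in> D \<longrightarrow> (\<forall>n. \<exists>j\<le>k. int (d n) < \<bar>q j n\<bar>) \<and>
    (\<forall>e x c A. (e = d \<or> e \<in> below d) \<longrightarrow> x \<in> lincombs k g (below d) \<longrightarrow>
      (\<exists>\<^sub>\<infinity>m. block_le k x (e m) (c * catcher k g (below e) e m)) \<longrightarrow>
      (\<exists>\<^sub>\<infinity>m. block_le k (\<lambda>i n. x i n + act k A q i n) (e m) (Suc c * catcher k g (below e) e m)))"
    for g :: "(nat \<Rightarrow> nat) \<Rightarrow> nat \<Rightarrow> nat \<Rightarrow> int" and d q
  have inf: "infinite D"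
    using unc infinite_iff_card_of_nat ordLess_imp_ordLeq by blast
  have "\<exists>g. \<forall>d. P g d (g d)"
  proof (rule dependent_wf_choice[OF R(1)])
    fix g g' :: "(nat \<Rightarrow> nat) \<Rightarrow> nat \<Rightarrow> nat \<Rightarrow> int" and d q
    assume eq: "\<And>e. (e, d) \<in> R \<Longrightarrow> g e = g' e"
    then have lin: "lincombs k g (below d) = lincombs k g' (below d)"
      by (intro lincombs_cong) (simp add: below_def)
    \<comment> \<open>By transitivity everything below such an \<open>e\<close> is also below
      \<open>d\<close>, where \<open>g\<close> and \<open>g'\<close> agree.\<close>
    have cat: "catcher k g (below e) = catcher k g' (below e)" if "e = d \<or> e \<in> below d" for e
      using that eq transD[OF R(2)] by (intro catcher_cong) (auto simp: below_def)
    show "P g d q = P g' d q"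
      unfolding P_def lin by (simp add: cat cong: conj_cong imp_cong)
  next
    fix d and g :: "(nat \<Rightarrow> nat) \<Rightarrow> nat \<Rightarrow> nat \<Rightarrow> int"
    show "\<exists>q. P g d q"
    proof (cases "d \<in> D")
      case False
      then show ?thesis
        by (simp add: P_def)
    next
      case True
      have below: "|below d| <o |D|" "below d \<subseteq> D"
        using R(3,4) True by (auto simp: below_def)
      obtain X where X: "|X| <o |D|" "\<And>x. x \<in> lincombs k g (below d) \<Longrightarrow> \<exists>y\<in>X. \<forall>i<k. y i = x i"
        using lincombs_small[OF unc below(1)] by blast
      define F where "F e = catcher k g (below e) e" for e
      have F: "m \<le> F e m" if "e = d \<or> e \<in> below d" for e m
        unfolding F_def
        by (rule catcher(1)[OF D(1) unc]) (use that below(2) True R(4) in \<open>auto simp: below_def\<close>)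
      define catch where "catch = (\<lambda>(y, e, c). ({m. block_le k y (e m) (c * F e m)}, e))"
      \<comment> \<open>Pairs whose first component is finite are dropped: for them the tuple is not
        caught infinitely often and nothing is claimed.\<close>
      define Z where "Z = catch ` (X \<times> (below d \<union> {d}) \<times> UNIV) \<inter> {z. infinite (fst z)}"
      have "|{d}| <o |D|"
        using inf by (simp add: finite_ordLess_infinite card_of_well_order_on Field_card_of)
      then have "|X \<times> (below d \<union> {d}) \<times> (UNIV :: nat set)| <o |D|"
        by (intro Times_ordLess[OF unc] X(1) unc card_of_Un_ordLess_infinite[OF inf] below(1))
      moreover have "|Z| \<le>o |X \<times> (below d \<union> {d}) \<times> (UNIV :: nat set)|"
        unfolding Z_def by (rule surj_imp_ordLeq) blast
      ultimately have "|Z| <o |D|"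
        using ordLeq_ordLess_trans by blast
      then have Z_small: "|Z| <o cardinal_d' I"
        using D(2) by (rule ordLess_ordIso_trans)
      have Z_infinite: "\<forall>z\<in>Z. infinite (fst z)"
        by (simp add: Z_def)
      obtain q where q: "\<And>n. \<exists>j\<le>k. int (d n) < \<bar>q j n\<bar>"
        "\<And>N H A. (N, H) \<in> Z \<Longrightarrow> \<exists>\<^sub>\<infinity>m. m \<in> N \<and> block_le k (act k A q) (H m) m"
        using one_step[OF I Z_small Z_infinite, where k = k and d = d] by blast
      have "\<exists>\<^sub>\<infinity>m. block_le k (\<lambda>i n. x i n + act k A q i n) (e m) (Suc c * F e m)"
        if e: "e = d \<or> e \<in> below d" and x: "x \<in> lincombs k g (below d)"
          and x_inf: "\<exists>\<^sub>\<infinity>m. block_le k x (e m) (c * F e m)" for e x c A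
      proof -
        obtain y where y: "y \<in> X" "\<forall>i<k. y i = x i"
          using X(2)[OF x] by blast
        then have y_eq: "block_le k y N B \<longleftrightarrow> block_le k x N B" for N B
          using block_le_cong by blast
        have "infinite {m. block_le k y (e m) (c * F e m)}"
          using x_inf by (simp add: y_eq frequently_cofinite)
        then have "({m. block_le k y (e m) (c * F e m)}, e) \<in> Z"
          using y(1) e unfolding Z_def catch_def by force
        from q(2)[OF this, of A] show ?thesis
        proof (rule INFM_mono)
          fix m
          assume m: "m \<in> {m. block_le k y (e m) (c * F e m)} \<and> block_le k (act k A q) (e m) m"
          show "block_le k (\<lambda>i n. x i n + act k A q i n) (e m) (Suc c * F e m)"
            unfolding block_le_def
          proof (intro allI impI)
            fix i n
            assume i: "i < k" "n < e m"
            have "\<bar>x i n + act k A q i n\<bar> \<le> \<bar>x i n\<bar> + \<bar>act k A q i n\<bar>"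
              by (rule abs_triangle_ineq)
            also have "\<bar>x i n\<bar> = \<bar>y i n\<bar>"
              using y(2) i(1) by simp
            also have "\<bar>y i n\<bar> + \<bar>act k A q i n\<bar> \<le> int (c * F e m) + int m"
              using m i unfolding block_le_def by (intro add_mono) auto
            also have "\<dots> \<le> int (Suc c * F e m)"
              using F[OF e, of m] by simp
            finally show "\<bar>x i n + act k A q i n\<bar> \<le> int (Suc c * F e m)" .
          qed
        qed
      qed
      then show ?thesis
        using q(1) unfolding P_def F_def by blast
    qed
  qed
  then obtain g where g: "\<And>d. P g d (g d)"
    by blast
  show thesis
  proof (rule that[of g])
    show "\<exists>j\<le>k. int (d n) < \<bar>g d j n\<bar>" if "d \<in> D" for d n
      using g[of d] that unfolding P_def by blast
    show "\<exists>\<^sub>\<infinity>m. block_le k (\<lambda>i n. x i n + act k A (g d) i n) (e m)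
        (Suc c * catcher k g {e'. (e', e) \<in> R} e m)"
      if "d \<in> D" "e = d \<or> (e, d) \<in> R" "x \<in> lincombs k g {e. (e, d) \<in> R}"
        "\<exists>\<^sub>\<infinity>m. block_le k x (e m) (c * catcher k g {e'. (e', e) \<in> R} e m)" for d e x c A
      using g[of d] that unfolding P_def below_def by blast
  qed
qed

section \<open>The group\<close>

definition int_span :: "nat \<Rightarrow> ('b \<Rightarrow> nat \<Rightarrow> nat \<Rightarrow> int) \<Rightarrow> 'b set \<Rightarrow> (nat \<Rightarrow> int) set" where
  "int_span k g D = {\<lambda>n. \<Sum>e\<in>E. \<Sum>j\<le>k. a e j * g e j n | E a. finite E \<and> E \<subseteq> D}"

text \<open>Coefficients are extended by zero, so that several elements can be written over one
  common finite set of generators.\<close>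

lemma int_spanE:
  assumes "y \<in> int_span k g D"
  obtains E a where "finite E" "E \<subseteq> D"
    "\<forall>F. finite F \<longrightarrow> E \<subseteq> F \<longrightarrow> y = (\<lambda>n. \<Sum>e\<in>F. \<Sum>j\<le>k. a e j * g e j n)"
proof -
  obtain E a where E: "finite E" "E \<subseteq> D" "y = (\<lambda>n. \<Sum>e\<in>E. \<Sum>j\<le>k. a e j * g e j n)"
    using assms unfolding int_span_def by blast
  define a' where "a' e = (if e \<in> E then a e else (\<lambda>_. 0))" for e
  have "y n = (\<Sum>e\<in>F. \<Sum>j\<le>k. a' e j * g e j n)" if "finite F" "E \<subseteq> F" for F n
  proof -
    have "y n = (\<Sum>e\<in>E. \<Sum>j\<le>k. a' e j * g e j n)"
      by (simp add: E(3) a'_def)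
    also have "\<dots> = (\<Sum>e\<in>F. \<Sum>j\<le>k. a' e j * g e j n)"
      using that by (intro sum.mono_neutral_left) (auto simp: a'_def)
    finally show ?thesis .
  qed
  then have "\<forall>F. finite F \<longrightarrow> E \<subseteq> F \<longrightarrow> y = (\<lambda>n. \<Sum>e\<in>F. \<Sum>j\<le>k. a' e j * g e j n)"
    by (intro allI impI ext)
  with E(1,2) show thesis
    by (rule that)
qed

lemma int_spanI:
  assumes "finite E" "E \<subseteq> D"
  shows "(\<lambda>n. \<Sum>e\<in>E. \<Sum>j\<le>k. a e j * g e j n) \<in> int_span k g D"
  using assms unfolding int_span_def by blast

lemma subgroup_int_span: "subgroup (int_span k g D) baer_specker"
  unfolding subgroup_baer_specker_iff
proof (intro conjI ballI)
  show "(\<lambda>_. 0) \<in> int_span k g D"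
    using int_spanI[where E = "{}"] by simp
next
  fix x y
  assume x: "x \<in> int_span k g D" and y: "y \<in> int_span k g D"
  obtain E a where E: "finite E" "E \<subseteq> D"
    "\<forall>F. finite F \<longrightarrow> E \<subseteq> F \<longrightarrow> x = (\<lambda>n. \<Sum>e\<in>F. \<Sum>j\<le>k. a e j * g e j n)"
    using x by (rule int_spanE)
  obtain E' b where E': "finite E'" "E' \<subseteq> D"
    "\<forall>F. finite F \<longrightarrow> E' \<subseteq> F \<longrightarrow> y = (\<lambda>n. \<Sum>e\<in>F. \<Sum>j\<le>k. b e j * g e j n)"
    using y by (rule int_spanE)
  have "x = (\<lambda>n. \<Sum>e\<in>E \<union> E'. \<Sum>j\<le>k. a e j * g e j n)"
    by (rule E(3)[rule_format]) (use E(1) E'(1) in auto)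
  moreover have "y = (\<lambda>n. \<Sum>e\<in>E \<union> E'. \<Sum>j\<le>k. b e j * g e j n)"
    by (rule E'(3)[rule_format]) (use E(1) E'(1) in auto)
  ultimately have "(\<lambda>n. x n + y n) = (\<lambda>n. \<Sum>e\<in>E \<union> E'. \<Sum>j\<le>k. (a e j + b e j) * g e j n)"
    by (simp add: sum.distrib distrib_right)
  also have "\<dots> \<in> int_span k g D"
    using E E' by (intro int_spanI) auto
  finally show "(\<lambda>n. x n + y n) \<in> int_span k g D" .
next
  fix x
  assume "x \<in> int_span k g D"
  then obtain E a where E: "finite E" "E \<subseteq> D"
    "\<forall>F. finite F \<longrightarrow> E \<subseteq> F \<longrightarrow> x = (\<lambda>n. \<Sum>e\<in>F. \<Sum>j\<le>k. a e j * g e j n)"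
    by (rule int_spanE)
  have "x = (\<lambda>n. \<Sum>e\<in>E. \<Sum>j\<le>k. a e j * g e j n)"
    by (rule E(3)[rule_format]) (use E(1) in auto)
  then have "(\<lambda>n. - x n) = (\<lambda>n. \<Sum>e\<in>E. \<Sum>j\<le>k. - a e j * g e j n)"
    by (simp add: sum_negf)
  also have "\<dots> \<in> int_span k g D"
    using E by (intro int_spanI)
  finally show "(\<lambda>n. - x n) \<in> int_span k g D" .
qed

text \<open>Over the union of the \<open>k\<close> finite supports, the coefficients of the i-th
  element become the i-th rows of the matrices.\<close>

lemma int_span_tuple:
  assumes "\<And>i. i < k \<Longrightarrow> x i \<in> int_span k g D"
  shows "\<exists>y\<in>lincombs k g D. \<forall>i<k. y i = x i"
proof -
  define Q where "Q i p \<longleftrightarrow> finite (fst p) \<and> fst p \<subseteq> D \<and>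
      (\<forall>F. finite F \<longrightarrow> fst p \<subseteq> F \<longrightarrow> x i = (\<lambda>n. \<Sum>e\<in>F. \<Sum>j\<le>k. snd p e j * g e j n))"
    for i and p :: "'a set \<times> ('a \<Rightarrow> nat \<Rightarrow> int)"
  have "\<exists>p. i < k \<longrightarrow> Q i p" for i
  proof (cases "i < k")
    case True
    obtain E a where "finite E" "E \<subseteq> D"
      "\<forall>F. finite F \<longrightarrow> E \<subseteq> F \<longrightarrow> x i = (\<lambda>n. \<Sum>e\<in>F. \<Sum>j\<le>k. a e j * g e j n)"
      using assms[OF True] by (rule int_spanE)
    then have "Q i (E, a)"
      by (simp add: Q_def)
    then show ?thesis
      by blast
  qed simp
  then obtain p where p: "\<And>i. i < k \<Longrightarrow> Q i (p i)"
    by metis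
  define E a where "E i = fst (p i)" and "a i = snd (p i)" for i
  have E: "finite (E i)" "E i \<subseteq> D"
    "finite F \<Longrightarrow> E i \<subseteq> F \<Longrightarrow> x i = (\<lambda>n. \<Sum>e\<in>F. \<Sum>j\<le>k. a i e j * g e j n)"
    if "i < k" for i F
    using p[OF that] unfolding Q_def E_def a_def by simp_all
  define F where "F = (\<Union>i<k. E i)"
  define y where "y i n = (\<Sum>e\<in>F. act k (\<lambda>i. a i e) (g e) i n)" for i n
  have "y \<in> lincombs k g D"
    unfolding y_def using E(1,2) by (intro lincombsI) (auto simp: F_def)
  moreover have "\<forall>i<k. y i = x i"
  proof (intro allI impI)
    fix i
    assume i: "i < k"
    have "x i = (\<lambda>n. \<Sum>e\<in>F. \<Sum>j\<le>k. a i e j * g e j n)"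
      by (rule E(3)[OF i]) (use E(1) i in \<open>auto simp: F_def\<close>)
    then show "y i = x i"
      by (simp add: y_def act_def fun_eq_iff)
  qed
  ultimately show ?thesis
    by blast
qed

theorem theorem11:
  assumes "\<exists>I. admissible_partition I \<and> cardinal_d' I =o cardinal_d"
  shows "\<forall>k :: nat. \<exists>G. subgroup G baer_specker \<and>
           menger_bounded (bs_power G k) (bs_power_top G k) \<and>
           \<not> menger_bounded (bs_power G (k + 1)) (bs_power_top G (k + 1))"
proof
  fix k :: nat
  obtain I where I: "admissible_partition I" "cardinal_d' I =o cardinal_d"
    using assms by blast
  obtain D where dom: "dominating D" and D: "cardinal_d = |D|"
    unfolding cardinal_d_def by (rule least_card[of dominating, OF dominating_UNIV])
  have unc: "|UNIV :: nat set| <o |D|"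
    using dom by (rule nat_ordLess_dominating)
  have D_iso: "|D| =o cardinal_d" "|D| =o cardinal_d' I"
    using I(2) ordIso_symmetric by (auto simp: D intro: card_of_refl)
  obtain R where R: "wf R" "trans R" "total_on D R" "R \<subseteq> D \<times> D"
    "\<And>d. d \<in> D \<Longrightarrow> |{e. (e, d) \<in> R}| <o |D|"
    using small_initial_segments[of D] by blast
  obtain g where large: "\<And>d n. d \<in> D \<Longrightarrow> \<exists>j\<le>k. int (d n) < \<bar>g d j n\<bar>"
    and step: "\<And>d e x c A. \<lbrakk>d \<in> D; e = d \<or> (e, d) \<in> R; x \<in> lincombs k g {e. (e, d) \<in> R};
      \<exists>\<^sub>\<infinity>m. block_le k x (e m) (c * catcher k g {e'. (e', e) \<in> R} e m)\<rbrakk> \<Longrightarrow>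
      \<exists>\<^sub>\<infinity>m. block_le k (\<lambda>i n. x i n + act k A (g d) i n) (e m)
        (Suc c * catcher k g {e'. (e', e) \<in> R} e m)"
    using generators[OF I(1) D_iso unc R(1,2,4,5)] by blast
  define f where "f d = catcher k g {e. (e, d) \<in> R} d" for d
  have f_ge: "m \<le> f d m" if "d \<in> D" for d m
    unfolding f_def using D_iso(1) unc R(5)[OF that] by (rule catcher(1))

  \<comment> \<open>Induction on \<open>E\<close> by removing its largest stage. If all of
    \<open>E\<close> precedes \<open>d\<close>, the catcher at \<open>d\<close> works with
    \<open>c = 1\<close>; each stage from \<open>d\<close> on costs one more multiple of
    \<open>f d\<close>.\<close>
  have caught: "\<exists>c. \<exists>\<^sub>\<infinity>m. block_le k (\<lambda>i n. \<Sum>e\<in>E. act k (A e) (g e) i n) (d m) (c * f d m)"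
    if d: "d \<in> D" and "finite E" "E \<subseteq> D" for d E A
    using that(2,3)
  proof (induction E rule: finite_psubset_induct)
    case (psubset E)
    show ?case
    proof (cases "E \<subseteq> {e. (e, d) \<in> R}")
      case True
      with psubset.hyps show ?thesis
        using catcher(2)[OF D_iso(1) unc R(5)[OF d] lincombsI, of E k A g d]
        by (intro exI[of _ 1]) (simp add: f_def)
    next
      case False
      have "E \<noteq> {}" "total_on E R"
        using False R(3) psubset.prems by (auto simp: total_on_def)
      then obtain e where e: "e \<in> E" "\<And>e'. e' \<in> E \<Longrightarrow> e' \<noteq> e \<Longrightarrow> (e', e) \<in> R"
        using finite_total_max[of E R] psubset.hyps R(2) by blast
      have eD: "e \<in> D"
        using e(1) psubset.prems by blast
      have "d = e \<or> (d, e) \<in> R"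
      proof (rule ccontr)
        assume "\<not> ?thesis"
        then have "(e, d) \<in> R"
          using R(3) d eD by (auto simp: total_on_def)
        then have "(e', d) \<in> R" if "e' \<in> E" for e'
          using e(2)[OF that] transD[OF R(2), of e' e d] by (cases "e' = e") auto
        then have "E \<subseteq> {e. (e, d) \<in> R}"
          by blast
        with False show False
          by blast
      qed
      moreover obtain c where
        "\<exists>\<^sub>\<infinity>m. block_le k (\<lambda>i n. \<Sum>e\<in>E - {e}. act k (A e) (g e) i n) (d m) (c * f d m)"
        using psubset.IH[of "E - {e}"] psubset.prems e(1) by blast
      moreover have "(\<lambda>i n. \<Sum>e\<in>E - {e}. act k (A e) (g e) i n) \<in> lincombs k g {e'. (e', e) \<in> R}"
        using psubset.hyps e(2) by (intro lincombsI) auto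
      \<comment> \<open>In \<open>step\<close> the stage is the largest element \<open>e\<close>,
        while \<open>d\<close> is the earlier or equal stage whose function provides the
        blocks.\<close>
      ultimately have "\<exists>\<^sub>\<infinity>m. block_le k
          (\<lambda>i n. (\<Sum>e\<in>E - {e}. act k (A e) (g e) i n) + act k (A e) (g e) i n) (d m) (Suc c * f d m)"
        unfolding f_def by (intro step eD)
      moreover have "(\<Sum>e\<in>E - {e}. act k (A e) (g e) i n) + act k (A e) (g e) i n =
          (\<Sum>e\<in>E. act k (A e) (g e) i n)" for i n
        using psubset.hyps e(1) by (simp add: sum.remove[of E e])
      ultimately show ?thesis
        by (intro exI[of _ "Suc c"]) (simp only:)
    qed
  qed

  define G where "G = int_span k g D"
  have G: "subgroup G baer_specker"
    unfolding G_def by (rule subgroup_int_span)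
  moreover have "menger_bounded (bs_power G k) (bs_power_top G k)"
    using G
  proof (rule menger_bounded_bs_powerI)
    fix H :: "nat \<Rightarrow> nat"
    obtain d where d: "d \<in> D" "\<forall>\<^sub>\<infinity>n. H n \<le> d n"
      using dom unfolding dominating_def by blast
    \<comment> \<open>The constant \<open>c\<close> varies with \<open>x\<close>; the factor
      \<open>m\<close> exceeds it eventually, so one bound serves all tuples.\<close>
    have "\<exists>m. block_le k x (H m) (m * f d m)" if "\<forall>i<k. x i \<in> G" for x
    proof -
      obtain y where y: "y \<in> lincombs k g D" "\<forall>i<k. y i = x i"
        using int_span_tuple[of k x g D] \<open>\<forall>i<k. x i \<in> G\<close> unfolding G_def by blast
      then obtain c where "\<exists>\<^sub>\<infinity>m. block_le k y (d m) (c * f d m)"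
        using caught[OF d(1)] unfolding lincombs_def by blast
      moreover have "\<forall>\<^sub>\<infinity>m. H m \<le> d m \<and> c \<le> m"
        using d(2) by (intro eventually_conj) (simp_all add: MOST_ge_nat)
      ultimately obtain m where m: "block_le k y (d m) (c * f d m)" "H m \<le> d m" "c \<le> m"
        using frequently_ex[OF INFM_conjI] by blast
      then have "block_le k y (H m) (m * f d m)"
        by (intro block_le_mono[OF m(1)]) auto
      then show ?thesis
        using y(2) block_le_cong by blast
    qed
    then show "\<exists>F. \<forall>x. (\<forall>i<k. x i \<in> G) \<longrightarrow> (\<exists>m. block_le k x (H m) (F m))"
      by (intro exI[of _ "\<lambda>m. m * f d m"]) simp
  qed
  moreover have "\<not> menger_bounded (bs_power G (k + 1)) (bs_power_top G (k + 1))"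
    using G
  proof (rule not_menger_bounded_bs_powerI)
    fix h :: "nat \<Rightarrow> nat"
    obtain d where d: "d \<in> D" "\<forall>\<^sub>\<infinity>n. h n \<le> d n"
      using dom unfolding dominating_def by blast
    then obtain N where N: "\<And>n. N \<le> n \<Longrightarrow> h n \<le> d n"
      by (auto simp: MOST_nat_le)
    \<comment> \<open>\<open>d\<close> may fail to bound \<open>h\<close> at the finitely many
      positions below \<open>N\<close>. There some entry of \<open>g d\<close> still has absolute
      value at least 1, so its c-fold multiple exceeds \<open>h\<close>.\<close>
    define c where "c = Suc (\<Sum>n<N. h n)"
    define x where "x j n = int c * g d j n" for j n
    have "x j \<in> G" if "j < k + 1" for j
    proof -
      have "x j = (\<lambda>n. \<Sum>e\<in>{d}. \<Sum>j'\<le>k. (if j' = j then int c else 0) * g e j' n)"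
        using that by (auto simp: x_def if_distrib[of "\<lambda>t. t * _"] cong: if_cong)
      also have "\<dots> \<in> G"
        unfolding G_def using d(1) by (intro int_spanI) auto
      finally show ?thesis .
    qed
    moreover have "\<exists>j<k + 1. int (h n) < \<bar>x j n\<bar>" for n
    proof -
      obtain j where j: "j \<le> k" "int (d n) < \<bar>g d j n\<bar>"
        using large[OF d(1)] by blast
      have "int (h n) < int c * \<bar>g d j n\<bar>"
      proof (cases "n < N")
        case True
        then have "h n < c"
          using member_le_sum[of n "{..<N}" h] by (simp add: c_def)
        moreover have "int c * 1 \<le> int c * \<bar>g d j n\<bar>"
          using j(2) by (intro mult_left_mono) auto
        ultimately show ?thesis
          by linarith
      next
        case False
        then have "int (h n) < \<bar>g d j n\<bar>"
          using N[of n] j(2) by simp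
        also have "1 * \<bar>g d j n\<bar> \<le> int c * \<bar>g d j n\<bar>"
          by (intro mult_right_mono) (auto simp: c_def sum_nonneg)
        finally show ?thesis
          by simp
      qed
      then show ?thesis
        using j(1) by (intro exI[of _ j]) (simp add: x_def abs_mult)
    qed
    ultimately show "\<exists>x. (\<forall>i<k + 1. x i \<in> G) \<and> (\<forall>n. \<exists>i<k + 1. int (h n) < \<bar>x i n\<bar>)"
      by (intro exI[of _ x] conjI allI impI)
  qed
  ultimately show "\<exists>G. subgroup G baer_specker \<and>
      menger_bounded (bs_power G k) (bs_power_top G k) \<and>
      \<not> menger_bounded (bs_power G (k + 1)) (bs_power_top G (k + 1))"
    by blast
qed

end
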